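(* Let $\mathcal{H}$ be a real Hilbert space with inner product $\langle\cdot,\cdot\rangle$ and induced norm $\|\cdot\|$. Let $\Theta\subset\mathbb{R}^d$ be a square interval (hypercube). Let $\boldsymbol{a}:\Theta\to\mathcal{H}$ be a continuous map such that $\|\boldsymbol{a}(\boldsymbol{\theta})\|=1$ for all $\boldsymbol{\theta}\in\Theta$, and such that $\boldsymbol{a}$ is translation invariant, i.e. $\langle \boldsymbol{a}(\boldsymbol{\theta}),\boldsymbol{a}(\boldsymbol{\theta}')\rangle=\langle \boldsymbol{a}(\boldsymbol{\theta}-\boldsymbol{\tau}),\boldsymbol{a}(\boldsymbol{\theta}'-\boldsymbol{\tau})\rangle$ whenever all four arguments lie in $\Theta$. Let $K\geq 1$ be an integer, put $L=\lfloor K/2\rfloor$, and let $\boldsymbol{\theta}_1,\dots,\boldsymbol{\theta}_K\in\Theta$ be such that $\boldsymbol{a}(\boldsymbol{\theta}_1),\dots,\boldsymbol{a}(\boldsymbol{\theta}_K)$ are linearly independent. Let $\mathbf{G}\in\mathbb{R}^{K\times K}$ be the Gram matrix $\mathbf{G}(i,j)=\langle \boldsymbol{a}(\boldsymbol{\theta}_i),\boldsymbol{a}(\boldsymbol{\theta}_j)\rangle$. (1) Suppose there exist vectors $\boldsymbol{v}_1,\dots,\boldsymbol{v}_K\in\mathcal{H}$ and functions $c_1,\dots,c_K:\Theta\to\mathbb{R}$ such that $\hat{\boldsymbol{a}}(\boldsymbol{\theta})=\sum_{k=1}^K \boldsymbol{v}_k\, c_k(\boldsymbol{\theta})$ satisfies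 $\hat{\boldsymbol{a}}(\boldsymbol{\theta}_j)=\boldsymbol{a}(\boldsymbol{\theta}_j)$ for $j=1,\dots,K$ and, for some admissible parameters $\{\lambda_\ell\}_{\ell=0}^L$, $\{\boldsymbol{\omega}_\ell\}_{\ell=1}^L$, $$\langle\hat{\boldsymbol{a}}(\boldsymbol{\theta}),\hat{\boldsymbol{a}}(\boldsymbol{\theta}')\rangle=\lambda_0+\sum_{\ell=1}^L\lambda_\ell\cos\big(\boldsymbol{\omega}_\ell^{\mathsf T}(\boldsymbol{\theta}-\boldsymbol{\theta}')\big)\qquad\text{for all }\boldsymbol{\theta},\boldsymbol{\theta}'\in\Theta .$$ Then there exist admissible parameters $\{\lambda_\ell\}_{\ell=0}^L$, $\{\boldsymbol{\omega}_\ell\}_{\ell=1}^L$ such that $$\mathbf{G}(i,j)=\lambda_0+\sum_{\ell=1}^L\lambda_\ell\cos\big(\boldsymbol{\omega}_\ell^{\mathsf T}(\boldsymbol{\theta}_i-\boldsymbol{\theta}_j)\big)\qquad\text{for all } i,j\in\{1,\dots,K\}.$$ (2) Conversely, suppose there exist admissible parameters $\{\lambda_\ell\}_{\ell=0}^L$, $\{\boldsymbol{\omega}_\ell\}_{\ell=1}^L$ such that $$\mathbf{G}(i,j)=\lambda_0+\sum_{\ell=1}^L\lambda_\ell\cos\big(\boldsymbol{\omega}_\ell^{\mathsf T}(\boldsymbol{\theta}_i-\boldsymbol{\theta}_j)\big)\qquad\text{for all } i,j\in\{1,\dots,K\}.$$ For $k=1,\dots,K$ define $$c_k(\boldsymbol{\theta})=\lambda_0+\sum_{\ell=1}^L\lambda_\ell\cos\big(\boldsymbol{\omega}_\ell^{\mathsf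 T}(\boldsymbol{\theta}-\boldsymbol{\theta}_k)\big),\qquad \boldsymbol{v}_k=\sum_{j=1}^K \boldsymbol{a}(\boldsymbol{\theta}_j)\,\mathbf{G}^{-1}(k,j),$$ where $\mathbf{G}^{-1}(k,j)$ is the $(k,j)$ entry of $\mathbf{G}^{-1}$, and set $\hat{\boldsymbol{a}}(\boldsymbol{\theta})=\sum_{k=1}^K\boldsymbol{v}_k\,c_k(\boldsymbol{\theta})$. Then $\hat{\boldsymbol{a}}(\boldsymbol{\theta}_j)=\boldsymbol{a}(\boldsymbol{\theta}_j)$ for $j=1,\dots,K$, and there exist admissible parameters $\{\lambda'_\ell\}_{\ell=0}^L$, $\{\boldsymbol{\omega}'_\ell\}_{\ell=1}^L$ such that $$\langle\hat{\boldsymbol{a}}(\boldsymbol{\theta}),\hat{\boldsymbol{a}}(\boldsymbol{\theta}')\rangle=\lambda'_0+\sum_{\ell=1}^L\lambda'_\ell\cos\big({\boldsymbol{\omega}'_\ell}^{\mathsf T}(\boldsymbol{\theta}-\boldsymbol{\theta}')\big)\qquad\text{for all }\boldsymbol{\theta},\boldsymbol{\theta}'\in\Theta .$$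
   Context: Given an integer $K\ge 1$ and $L=\lfloor K/2\rfloor$, parameters $\{\lambda_\ell\}_{\ell=0}^L\subset\mathbb{R}$ and $\{\boldsymbol{\omega}_\ell\}_{\ell=1}^L\subset\mathbb{R}^d$ are called admissible if: (i) the kernel $(\boldsymbol{\theta},\boldsymbol{\theta}')\mapsto\lambda_0+\sum_{\ell=1}^L\lambda_\ell\cos(\boldsymbol{\omega}_\ell^{\mathsf T}(\boldsymbol{\theta}-\boldsymbol{\theta}'))$ on $\Theta\times\Theta$ is positive semidefinite; and (ii) $\lambda_0=0$ if $K$ is even, and $\lambda_0>0$ if $K$ is odd. Since the atoms $\boldsymbol{a}(\boldsymbol{\theta}_1),\dots,\boldsymbol{a}(\boldsymbol{\theta}_K)$ are assumed linearly independent, $\mathbf{G}$ is invertible. An empty sum (case $L=0$) equals $0$. *)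

theory Defs
  imports "HOL-Analysis.Analysis"
begin

text \<open>Product of intervals of one common length \<open>s > 0\<close>; each interval may or may not contain
  either of its end points, so closed, open and half-open cubes are all included.\<close>

definition hypercube :: "(real ^ 'd) set \<Rightarrow> bool" where
  "hypercube \<Theta> \<longleftrightarrow> (\<exists>(s::real) (l :: real ^ 'd) (J :: 'd \<Rightarrow> real set). 0 < s \<and>
     (\<forall>i. {l $ i <..< l $ i + s} \<subseteq> J i \<and> J i \<subseteq> {l $ i .. l $ i + s}) \<and>
     \<Theta> = {x. \<forall>i. x $ i \<in> J i})"

definition translation_invariant_on ::
    "'p::ab_group_add set \<Rightarrow> ('p \<Rightarrow> 'h::real_inner) \<Rightarrow> bool" where
  "translation_invariant_on \<Theta> a \<longleftrightarrow>
     (\<forall>x y \<tau>. x \<in> \<Theta> \<longrightarrow> y \<in> \<Theta> \<longrightarrow> x - \<tau> \<in> \<Theta> \<longrightarrow> y - \<tau> \<in> \<Theta> \<longrightarrow>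
        a x \<bullet> a y = a (x - \<tau>) \<bullet> a (y - \<tau>))"

text \<open>Linear independence of a family, so repeated vectors are excluded by injectivity.\<close>

definition independent_family :: "('k \<Rightarrow> 'h::real_vector) \<Rightarrow> bool" where
  "independent_family f \<longleftrightarrow> inj f \<and> independent (range f)"

definition gram_matrix :: "('k \<Rightarrow> 'h::real_inner) \<Rightarrow> real ^ 'k ^ 'k" where
  "gram_matrix f = (\<chi> i j. f i \<bullet> f j)"

definition psd_kernel_on :: "'p set \<Rightarrow> ('p \<Rightarrow> 'p \<Rightarrow> real) \<Rightarrow> bool" where
  "psd_kernel_on S \<kappa> \<longleftrightarrow>
     (\<forall>x\<in>S. \<forall>y\<in>S. \<kappa> x y = \<kappa> y x) \<and>
     (\<forall>(n::nat) (x :: nat \<Rightarrow> 'p) (c :: nat \<Rightarrow> real). (\<forall>i<n. x i \<in> S) \<longrightarrow>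
        0 \<le> (\<Sum>i<n. \<Sum>j<n. c i * c j * \<kappa> (x i) (x j)))"

text \<open>Only \<open>lam 0, \<dots>, lam L\<close> and \<open>\<omega> 1, \<dots>, \<omega> L\<close> with \<open>L = K div 2\<close> are used; the values of
  the two sequences at other indices are irrelevant.\<close>

definition cos_kernel ::
    "nat \<Rightarrow> (nat \<Rightarrow> real) \<Rightarrow> (nat \<Rightarrow> 'p::real_inner) \<Rightarrow> 'p \<Rightarrow> 'p \<Rightarrow> real" where
  "cos_kernel K lam \<omega> x y = lam 0 + (\<Sum>l = 1..K div 2. lam l * cos (\<omega> l \<bullet> (x - y)))"

definition admissible ::
    "'p::real_inner set \<Rightarrow> nat \<Rightarrow> (nat \<Rightarrow> real) \<Rightarrow> (nat \<Rightarrow> 'p) \<Rightarrow> bool" where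
  "admissible \<Theta> K lam \<omega> \<longleftrightarrow>
     psd_kernel_on \<Theta> (cos_kernel K lam \<omega>) \<and>
     (even K \<longrightarrow> lam 0 = 0) \<and> (odd K \<longrightarrow> lam 0 > 0)"

definition combination ::
    "('k::finite \<Rightarrow> 'h::real_vector) \<Rightarrow> ('k \<Rightarrow> 'p \<Rightarrow> real) \<Rightarrow> 'p \<Rightarrow> 'h" where
  "combination v c x = (\<Sum>k\<in>UNIV. c k x *\<^sub>R v k)"

end

theory Submission imports Defs begin

text \<open>Only part (2) needs an argument, and there the given parameters already work. By the
  addition formula for cosine the kernel is \<open>\<kappa> x y = u x \<bullet> (D *v u y)\<close> with \<open>D\<close> diagonal and
  \<open>u\<close> taking values in a space of dimension exactly \<open>K\<close>: each frequency contributes a cosine and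
  a sine, and the constant feature is present precisely when \<open>K\<close> is odd. Hence \<open>G = P D P\<^sup>T\<close>
  with a square matrix \<open>P\<close>, and invertibility of \<open>G\<close> makes the reproduction formula
  \<open>c x \<bullet> (G\<^sup>-\<^sup>1 *v c y) = \<kappa> x y\<close> exact, where \<open>c x = P D u x\<close>.\<close>

lemma matrix_inv_right:
  fixes A :: "'a::semiring_1 ^ 'n ^ 'm"
  assumes "invertible A"
  shows "A ** matrix_inv A = mat 1"
  using assms unfolding invertible_def matrix_inv_def by (rule someI2_ex) simp

lemma independent_family_sum_eq_0:
  fixes f :: "'k::finite \<Rightarrow> 'h::real_vector"
  assumes "independent_family f" and "(\<Sum>k\<in>UNIV. z k *\<^sub>R f k) = 0"
  shows "z k = 0"
proof -
  have inj: "inj f" and ind: "independent (range f)"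
    using assms(1) by (auto simp: independent_family_def)
  have "(\<Sum>w\<in>range f. z (inv f w) *\<^sub>R w) = 0"
    using assms(2) inj by (simp add: sum.reindex)
  then have "z (inv f (f k)) = 0"
    using ind by (intro independentD[of "range f" "range f"]) auto
  then show ?thesis
    using inj by simp
qed

text \<open>Serves twice: with \<open>y = z\<close> it gives definiteness of the Gram matrix, and
  later it evaluates inner products of interpolants from their coordinates.\<close>

lemma gram_matrix_mult_inner:
  "y \<bullet> (gram_matrix f *v z) = (\<Sum>i\<in>UNIV. y $ i *\<^sub>R f i) \<bullet> (\<Sum>j\<in>UNIV. z $ j *\<^sub>R f j)"
  by (simp add: inner_vec_def matrix_vector_mult_def gram_matrix_def inner_sum_left
      inner_sum_right sum_distrib_left ac_simps)
    (rule sum.swap)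

lemma invertible_gram_matrix:
  fixes f :: "'k::finite \<Rightarrow> 'h::real_inner"
  assumes "independent_family f"
  shows "invertible (gram_matrix f)"
proof -
  have "z = 0" if "gram_matrix f *v z = 0" for z
  proof -
    \<comment> \<open>The quadratic form at a kernel vector \<open>z\<close> is the squared norm of
      this combination.\<close>
    have "(\<Sum>j\<in>UNIV. z $ j *\<^sub>R f j) = 0"
      using gram_matrix_mult_inner[of z f z] that by simp
    then have "z $ k = 0" for k
      using independent_family_sum_eq_0[OF assms, of "($) z"] by simp
    then show "z = 0"
      by (simp add: vec_eq_iff)
  qed
  then show ?thesis
    by (simp add: invertible_left_inverse matrix_left_invertible_ker)
qed

text \<open>Groups the features by frequency, a cosine with its sine.\<close>

lemma sum_pairs:
  fixes g :: "nat \<Rightarrow> 'a::comm_monoid_add"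
  shows "(\<Sum>n = 2..<2 * L + 2. g n) = (\<Sum>l = 1..L. g (2 * l) + g (2 * l + 1))"
proof (induction L)
  case (Suc L)
  have "(\<Sum>n = 2..<2 * Suc L + 2. g n)
      = (\<Sum>n = 2..<2 * L + 2. g n) + g (2 * L + 2) + g (2 * L + 3)"
    by (simp add: numeral_3_eq_3)
  then show ?case
    using Suc by (simp add: add.assoc numeral_3_eq_3)
qed simp

lemma cos_kernel_features:
  fixes \<omega> :: "nat \<Rightarrow> 'p::real_inner"
  assumes "even K \<Longrightarrow> lam 0 = 0" and K: "K = CARD('k::finite)"
  obtains d :: "'k::finite \<Rightarrow> real" and \<phi> :: "'k::finite \<Rightarrow> 'p \<Rightarrow> real"
  where "\<And>x y. cos_kernel K lam \<omega> x y = (\<Sum>m\<in>UNIV. d m * \<phi> m x * \<phi> m y)"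
proof -
  \<comment> \<open>Index \<open>1\<close> is the constant feature, \<open>2 l\<close> and \<open>2 l + 1\<close> are the cosine and the sine
    of frequency \<open>\<omega> l\<close>.\<close>
  define I where "I = {(if even K then 2 else 1)..<2 * (K div 2) + 2}"
  \<comment> \<open>Halving sends both indices of frequency \<open>l\<close> to
    \<open>lam l\<close>, and index \<open>1\<close> to \<open>lam 0\<close>.\<close>
  define e where "e n = lam (n div 2)" for n
  define \<psi> where "\<psi> n x = (if n = 1 then 1 else if even n then cos (\<omega> (n div 2) \<bullet> x)
    else sin (\<omega> (n div 2) \<bullet> x))" for n x
  \<comment> \<open>For even \<open>K\<close> the indices are \<open>2, ..., K + 1\<close>, for odd
    \<open>K\<close> they are \<open>1, ..., K\<close>.\<close>
  have "card I = CARD('k)"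
    unfolding I_def K[symmetric] by (auto elim!: evenE oddE)
  then obtain b :: "'k \<Rightarrow> nat" where b: "bij_betw b UNIV I"
    using finite_same_card_bij[of "UNIV :: 'k set" I] by (auto simp: I_def)
  have "cos_kernel K lam \<omega> x y = (\<Sum>m\<in>UNIV. e (b m) * \<psi> (b m) x * \<psi> (b m) y)" for x y
  proof -
    let ?g = "\<lambda>n. e n * \<psi> n x * \<psi> n y"
    have "(\<Sum>m\<in>UNIV. ?g (b m)) = sum ?g I"
      using b by (rule sum.reindex_bij_betw)
    also have "\<dots> = lam 0 + (\<Sum>n = 2..<2 * (K div 2) + 2. ?g n)"
    proof (cases "even K")
      case False
      then have "I = insert 1 {2..<2 * (K div 2) + 2}"
        by (auto simp: I_def odd_pos)
      then show ?thesis
        by (simp add: e_def \<psi>_def)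
    qed (use assms(1) in \<open>simp add: I_def\<close>)
    also have "\<dots> = lam 0 + (\<Sum>l = 1..K div 2. ?g (2 * l) + ?g (2 * l + 1))"
      by (simp only: sum_pairs)
    also have "\<dots> = cos_kernel K lam \<omega> x y"
      unfolding cos_kernel_def
      by (intro arg_cong2[where f = "(+)"] sum.cong refl)
        (auto simp: e_def \<psi>_def inner_diff_right cos_diff algebra_simps)
    finally show ?thesis by simp
  qed
  then show thesis
    by (rule that)
qed

lemma kernel_reproduction:
  fixes \<phi> :: "'k::finite \<Rightarrow> 'p \<Rightarrow> real" and \<kappa> :: "'p \<Rightarrow> 'p \<Rightarrow> real" and G H :: "real ^ 'k ^ 'k"
  assumes \<kappa>: "\<And>x y. \<kappa> x y = (\<Sum>m\<in>UNIV. d m * \<phi> m x * \<phi> m y)"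
    and G: "\<And>i j. G $ i $ j = \<kappa> (\<theta> i) (\<theta> j)" and H: "G ** H = mat 1"
  shows "(\<chi> k. \<kappa> x (\<theta> k)) \<bullet> (H *v (\<chi> k. \<kappa> y (\<theta> k))) = \<kappa> x y"
proof -
  \<comment> \<open>All weights \<open>d\<close> go into \<open>Q\<close>, so no square roots and no
    signs of \<open>d\<close> are involved.\<close>
  define P :: "real ^ 'k ^ 'k" where "P = (\<chi> i m. \<phi> m (\<theta> i))"
  define Q :: "real ^ 'k ^ 'k" where "Q = (\<chi> i m. d m * \<phi> m (\<theta> i))"
  define u where "u x = (\<chi> m. \<phi> m x)" for x
  have c: "(\<chi> k. \<kappa> x (\<theta> k)) = Q *v u x" for x
    by (simp add: vec_eq_iff \<kappa> Q_def u_def matrix_vector_mult_def ac_simps)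
  have "G = Q ** transpose P"
    by (simp add: vec_eq_iff G \<kappa> P_def Q_def matrix_matrix_mult_def transpose_def)
  then have "Q ** (transpose P ** H) = mat 1"
    using H by (simp add: matrix_mul_assoc)
  \<comment> \<open>This is where \<open>Q\<close> being square enters.\<close>
  then have inv: "(transpose P ** H) ** Q = mat 1"
    by (simp add: matrix_left_right_inverse)
  \<comment> \<open>Moving the weights onto the vector leaves \<open>P\<close>, whose transpose
    forms with \<open>H\<close> the inverse of \<open>Q\<close>.\<close>
  have "Q *v u x = P *v (\<chi> m. d m * \<phi> m x)"
    by (simp add: vec_eq_iff P_def Q_def u_def matrix_vector_mult_def ac_simps)
  then have "(Q *v u x) \<bullet> (H *v (Q *v u y))
    = (\<chi> m. d m * \<phi> m x) \<bullet> (transpose P *v (H *v (Q *v u y)))"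
    by (simp add: dot_lmul_matrix[symmetric] inner_commute)
  also have "\<dots> = (\<chi> m. d m * \<phi> m x) \<bullet> u y"
    using inv by (simp add: matrix_vector_mul_assoc matrix_mul_assoc)
  also have "\<dots> = \<kappa> x y"
    by (simp add: \<kappa> u_def inner_vec_def)
  finally show ?thesis
    by (simp add: c)
qed

text \<open>Passes from the dual vectors back to coordinates in \<open>f\<close>, where the Gram
  matrix computes inner products.\<close>

lemma combination_dual_basis:
  fixes f :: "'k::finite \<Rightarrow> 'h::real_vector"
  shows "combination (\<lambda>k. \<Sum>j\<in>UNIV. H $ k $ j *\<^sub>R f j) c x
    = (\<Sum>j\<in>UNIV. ((\<chi> k. c k x) v* H) $ j *\<^sub>R f j)"
  unfolding combination_def scaleR_sum_right
  by (subst sum.swap) (simp add: vector_matrix_mult_def scaleR_sum_left mult.commute)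

theorem theorem1:
  fixes \<Theta> :: "(real ^ 'd) set"
    and a :: "real ^ 'd \<Rightarrow> 'h::{real_inner, complete_space}"
    and \<theta> :: "'k::finite \<Rightarrow> real ^ 'd"
    and K :: nat
    and G :: "real ^ 'k ^ 'k"
  assumes "hypercube \<Theta>"
    and "continuous_on \<Theta> a"
    and "\<forall>x\<in>\<Theta>. norm (a x) = 1"
    and "translation_invariant_on \<Theta> a"
    and "K = CARD('k)"
    and "\<forall>k. \<theta> k \<in> \<Theta>"
    and "independent_family (\<lambda>k. a (\<theta> k))"
    and "G = gram_matrix (\<lambda>k. a (\<theta> k))"
  shows
    "((\<exists>(v :: 'k \<Rightarrow> 'h) (c :: 'k \<Rightarrow> real ^ 'd \<Rightarrow> real).
         (\<forall>j. combination v c (\<theta> j) = a (\<theta> j)) \<and>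
         (\<exists>lam \<omega>. admissible \<Theta> K lam \<omega> \<and>
            (\<forall>x\<in>\<Theta>. \<forall>y\<in>\<Theta>. combination v c x \<bullet> combination v c y = cos_kernel K lam \<omega> x y)))
      \<longrightarrow> (\<exists>lam \<omega>. admissible \<Theta> K lam \<omega> \<and>
            (\<forall>i j. G $ i $ j = cos_kernel K lam \<omega> (\<theta> i) (\<theta> j))))
     \<and>
     (\<forall>lam \<omega>. admissible \<Theta> K lam \<omega> \<and>
          (\<forall>i j. G $ i $ j = cos_kernel K lam \<omega> (\<theta> i) (\<theta> j))
      \<longrightarrow> (let c = (\<lambda>k x. cos_kernel K lam \<omega> x (\<theta> k));
               v = (\<lambda>k. \<Sum>j\<in>UNIV. matrix_inv G $ k $ j *\<^sub>R a (\<theta> j))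
           in (\<forall>j. combination v c (\<theta> j) = a (\<theta> j)) \<and>
              (\<exists>lam' \<omega>'. admissible \<Theta> K lam' \<omega>' \<and>
                 (\<forall>x\<in>\<Theta>. \<forall>y\<in>\<Theta>.
                    combination v c x \<bullet> combination v c y = cos_kernel K lam' \<omega>' x y))))"
proof (intro conjI impI allI, goal_cases)
  case 1
  then obtain v :: "'k \<Rightarrow> 'h" and c lam \<omega> where
    int: "\<And>j. combination v c (\<theta> j) = a (\<theta> j)" and adm: "admissible \<Theta> K lam \<omega>" and
    ker: "\<forall>x\<in>\<Theta>. \<forall>y\<in>\<Theta>. combination v c x \<bullet> combination v c y = cos_kernel K lam \<omega> x y"
    by blast
  \<comment> \<open>Interpolation lets the kernel identity be read off at the nodes, with the same
    parameters.\<close>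
  have "G $ i $ j = cos_kernel K lam \<omega> (\<theta> i) (\<theta> j)" for i j
    using ker assms(6) by (simp add: assms(8) gram_matrix_def int[symmetric])
  with adm show ?case
    by blast
next
  case (2 lam \<omega>)
  then have adm: "admissible \<Theta> K lam \<omega>" and
    G: "\<And>i j. G $ i $ j = cos_kernel K lam \<omega> (\<theta> i) (\<theta> j)"
    by auto
  define H where "H = matrix_inv G"
  define c where "c = (\<lambda>k x. cos_kernel K lam \<omega> x (\<theta> k))"
  define v where "v = (\<lambda>k. \<Sum>j\<in>UNIV. H $ k $ j *\<^sub>R a (\<theta> j))"
  define C where "C x = (\<chi> k. c k x)" for x
  have GH: "G ** H = mat 1"
    unfolding H_def assms(8) by (intro matrix_inv_right invertible_gram_matrix assms(7))
  have comb: "combination v c x = (\<Sum>j\<in>UNIV. (C x v* H) $ j *\<^sub>R a (\<theta> j))" for x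
    unfolding v_def C_def by (rule combination_dual_basis)
  \<comment> \<open>At a node, \<open>C\<close> is a row of \<open>G\<close>, which \<open>H\<close>
    turns into a unit vector.\<close>
  have "C (\<theta> j) v* H = axis j 1" for j
  proof -
    have "C (\<theta> j) = axis j 1 v* G"
      by (simp add: vec_eq_iff C_def c_def G vector_matrix_mult_def axis_def
          if_distrib[of "\<lambda>t. t * _"] cong: if_cong)
    then show ?thesis
      by (simp add: vector_matrix_mul_assoc GH)
  qed
  then have int: "combination v c (\<theta> j) = a (\<theta> j)" for j
    by (simp add: comb axis_def if_distrib[of "\<lambda>t. t *\<^sub>R _"] cong: if_cong)
  obtain d :: "'k \<Rightarrow> real" and \<phi> where
    \<phi>: "\<And>x y. cos_kernel K lam \<omega> x y = (\<Sum>m\<in>UNIV. d m * \<phi> m x * \<phi> m y)"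
    using cos_kernel_features[of K lam, OF _ assms(5)] adm unfolding admissible_def by metis
  have "combination v c x \<bullet> combination v c y = cos_kernel K lam \<omega> x y" for x y
  proof -
    have "combination v c x \<bullet> combination v c y = (C y v* H) \<bullet> (G *v (C x v* H))"
      by (simp add: comb assms(8) gram_matrix_mult_inner inner_commute)
    also have "\<dots> = C y \<bullet> (H *v (G *v (C x v* H)))"
      by (simp add: dot_lmul_matrix)
    \<comment> \<open>Squareness turns the right inverse \<open>H\<close> into a left inverse, so
      one of the two factors \<open>H\<close> cancels \<open>G\<close>.\<close>
    also have "\<dots> = C y \<bullet> (C x v* H)"
      using GH matrix_left_right_inverse[of G H] by (simp add: matrix_vector_mul_assoc)
    also have "\<dots> = C x \<bullet> (H *v C y)"
      by (metis dot_lmul_matrix inner_commute)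
    also have "\<dots> = cos_kernel K lam \<omega> x y"
      unfolding C_def c_def using \<phi> G GH
      by (rule kernel_reproduction[where \<kappa> = "cos_kernel K lam \<omega>"])
    finally show ?thesis .
  qed
  with int adm show ?case
    unfolding Let_def c_def v_def H_def by blast
qed

end
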